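(* Let $n\ge 2$ be an integer, let $\alpha\in\mathbb{R}$, $p>1$ and let $m\ge 1$ be a given integer. Then $$\int_{\mathbb{R}^n}|x|^{\alpha}|\Delta^m u|^p\,dx\ \ge\ \left|n-\frac{n+\alpha}{p}\right|^p\int_{\mathbb{R}^n}|x|^{\alpha-p}|\nabla(\Delta^{m-1}u)|^{p}\,dx$$ for any $u\in C^{2m}_{c,r}(\mathbb{R}^n\setminus\{0\})$. The constant in the right hand side is sharp (it cannot be replaced by any larger constant).
   Context: $C^{2m}_{c,r}(\mathbb{R}^n\setminus\{0\})$ is the space of radially symmetric functions in $C^{2m}_c(\mathbb{R}^n\setminus\{0\})$. By convention $\Delta^0u=u$. *)

theory Defs
  imports "HOL-Analysis.Analysis"
begin

definition partial :: "'n::finite \<Rightarrow> (real^'n \<Rightarrow> real) \<Rightarrow> real^'n \<Rightarrow> real" where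
  "partial i f x = deriv (\<lambda>t. f (x + t *\<^sub>R axis i 1)) 0"

definition grad :: "(real^'n::finite \<Rightarrow> real) \<Rightarrow> real^'n \<Rightarrow> real^'n" where
  "grad f x = (\<chi> i. partial i f x)"

definition laplacian :: "(real^'n::finite \<Rightarrow> real) \<Rightarrow> real^'n \<Rightarrow> real" where
  "laplacian f x = (\<Sum>i\<in>UNIV. partial i (partial i f) x)"

(* Intended for open S. Total differentiability is demanded at each level below the top
   one, so that the partial derivatives taken with the total function deriv are meaningful. *)
primrec Ck_on :: "nat \<Rightarrow> (real^'n::finite) set \<Rightarrow> (real^'n \<Rightarrow> real) \<Rightarrow> bool" where
  "Ck_on 0 S f \<longleftrightarrow> continuous_on S f"
| "Ck_on (Suc k) S f \<longleftrightarrow> (\<forall>x\<in>S. f differentiable (at x)) \<and> (\<forall>i. Ck_on k S (partial i f))"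

definition radially_symmetric :: "('a::real_normed_vector \<Rightarrow> 'b) \<Rightarrow> bool" where
  "radially_symmetric u \<longleftrightarrow> (\<forall>x y. norm x = norm y \<longrightarrow> u x = u y)"

(* The radial C^k functions with compact support in the punctured space, extended by zero:
   the last two conditions say that the support is a compact subset of UNIV - {0}. *)
definition Ccr_punctured :: "nat \<Rightarrow> (real^'n::finite \<Rightarrow> real) set" where
  "Ccr_punctured k = {u. Ck_on k (UNIV - {0}) u \<and> radially_symmetric u \<and>
     compact (closure {x. u x \<noteq> 0}) \<and> closure {x. u x \<noteq> 0} \<subseteq> UNIV - {0}}"

end

(* For u radial, v = Delta^(m-1) u is again radial, say v(x) = f(|x|), and
   Delta v = r^(1-n) (r^(n-1) f')'. In polar coordinates the inequality is therefore a weighted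
   one-dimensional Hardy inequality for w = r^(n-1) f'. It follows by integrating the pointwise tangent
   inequality |A|^p >= |B|^p + p |B|^(p-2) B (A - B) with A = r w' and B = -kappa w, because the
   last term is then an exact derivative.

   For sharpness take u(x) = |x|^s phi(eps ln |x|) with s chosen so that all the powers of |x|
   in the two integrals cancel to dr/r. In the variable t = eps ln r, the Laplacian and the gradient act on
   phi as products of operators eps d/dt + a. The quotient of the two integrals
   tends to the claimed constant as eps tends to 0, once the common power of eps created by the
   vanishing numbers a is divided out. *)
theory Submission
  imports Defs "HOL-Computational_Algebra.Polynomial"
begin

section \<open>Polar coordinates and the one-dimensional Hardy inequality\<close>

text \<open>The choice B = -kappa w comes from the equality case: w = r^(-kappa) satisfies r w' =
  -kappa w, so the tangent inequality is an equality at every r. A pure power has no compact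
  support, but cutting it off on a logarithmic scale perturbs it only by terms of order \<epsilon>.
  The obstacle to sharpness is that some numbers a vanish for special \<alpha>. Then eps d/dt + a is
  just eps d/dt, the profiles in both integrals tend to zero, and the quotient has the form 0/0.
  Polynomial profiles settle this: the operators do not raise the degree, a degenerate factor is
  exactly \<epsilon> times differentiation, and a high initial degree keeps what remains nonzero.
  Since only finitely many derivatives are required, a power of t (1 - t) on [0,1], extended by
  zero, is smooth enough. The gradient and the last Laplacian have profiles F and (eps d/dt + b) F
  with the same F and b = n - (n + \<alpha>)/p, so only b survives in the limit, also when b =
  0.\<close>

text \<open>Both measures give \<open>{..r}\<close> the volume of the ball of radius
  \<open>r\<close>, on the right as the integral of its derivative in the radius. The half-lines are
  closed under intersection and generate the Borel sets.\<close>

lemma distr_norm_lborel: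
  "distr (lborel :: 'a::euclidean_space measure) borel norm =
     density lborel (\<lambda>r. ennreal (unit_ball_vol DIM('a) * (DIM('a) * r ^ (DIM('a) - 1))) * indicator {0..} r)"
    (is "?M = ?N")
proof (rule measure_eqI_generator_eq[where \<Omega> = UNIV and E = "range (atMost :: real \<Rightarrow> _)"
      and A = "\<lambda>k::nat. {..real k}"])
  show "Int_stable (range (atMost :: real \<Rightarrow> _))"
    by (auto simp: Int_stable_def)
  show "range (atMost :: real \<Rightarrow> _) \<subseteq> Pow UNIV" by simp
  fix X :: "real set"
  assume "X \<in> range atMost"
  then obtain r where X: "X = {..r}" by auto
  have pre: "norm -` X = cball (0::'a) r"
    by (auto simp: X)
  show "emeasure ?M X = emeasure ?N X"
  proof (cases "r \<ge> 0")
    case True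
    have "emeasure ?N X = (\<integral>\<^sup>+x. ennreal (unit_ball_vol DIM('a) * (DIM('a) * x ^ (DIM('a) - 1))) * indicator {0..r} x \<partial>lborel)"
      unfolding X by (subst emeasure_density) (auto intro!: nn_integral_cong simp: indicator_def)
    also have "\<dots> = ennreal (unit_ball_vol DIM('a) * r ^ DIM('a) - unit_ball_vol DIM('a) * 0 ^ DIM('a))"
      using True
      by (intro nn_integral_FTC_Icc) (auto intro!: derivative_eq_intros DIM_positive)
    also have "\<dots> = emeasure lborel (cball (0::'a) r)"
      using True by (simp add: emeasure_cball)
    also have "\<dots> = emeasure ?M X"
      unfolding pre[symmetric] by (subst emeasure_distr) (auto simp: X)
    finally show ?thesis by simp
  next
    case False
    then have "emeasure ?N X = (\<integral>\<^sup>+(x::real). 0 \<partial>lborel)"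
      unfolding X by (subst emeasure_density) (auto intro!: nn_integral_cong simp del: nn_integral_const simp: indicator_def)
    moreover have "emeasure ?M X = 0"
      using False pre by (subst emeasure_distr) (auto simp: X)
    ultimately show ?thesis by simp
  qed
next
  show "sets ?M = sigma_sets UNIV (range atMost)"
    by (simp add: borel_eq_atMost)
  show "sets ?N = sigma_sets UNIV (range atMost)"
    by (simp add: borel_eq_atMost)
  show "range (\<lambda>k::nat. {..real k}) \<subseteq> range atMost" by auto
  show "(\<Union>k::nat. {..real k}) = UNIV"
    using real_arch_simple by auto
  fix k :: nat
  have pre: "norm -` {..real k} = cball (0::'a) k"
    by auto
  show "emeasure ?M {..real k} \<noteq> \<infinity>"
    using emeasure_lborel_cball_finite[of "0::'a" "real k"]
    by (subst emeasure_distr) (auto simp: pre)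
qed

lemma integral_norm_lborel:
  fixes h :: "real \<Rightarrow> real"
  assumes [measurable]: "h \<in> borel_measurable borel"
  shows "(LINT x|(lborel :: 'a::euclidean_space measure). h (norm x)) =
    unit_ball_vol DIM('a) * DIM('a) * (LINT r|lborel. indicator {0..} r * (r ^ (DIM('a) - 1) * h r))"
proof -
  have "(LINT x|(lborel :: 'a measure). h (norm x)) = (LINT r|distr (lborel :: 'a measure) borel norm. h r)"
    by (subst integral_distr) auto
  also have "\<dots> = (LINT r|density lborel (\<lambda>r. ennreal (unit_ball_vol DIM('a) * (DIM('a) * r ^ (DIM('a) - 1)) * indicator {0..} r)). h r)"
    unfolding distr_norm_lborel
    by (intro arg_cong2[where f = "integral\<^sup>L"] density_cong AE_I2 refl) (auto simp: indicator_def)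
  also have "\<dots> = (LINT r|lborel. (unit_ball_vol DIM('a) * (DIM('a) * r ^ (DIM('a) - 1)) * indicator {0..} r) * h r)"
    by (subst integral_density) (auto simp: indicator_def)
  also have "\<dots> = (LINT r|lborel. (unit_ball_vol DIM('a) * DIM('a)) * (indicator {0..} r * (r ^ (DIM('a) - 1) * h r)))"
    by (intro Bochner_Integration.integral_cong) auto
  finally show ?thesis by simp
qed

text \<open>Profiles are controlled only on a compact interval of radii. Multiplying
  \<open>h\<close> by the indicator of that interval gives a Borel function on the whole line, even
  if it jumps at the endpoints.\<close>

lemma integral_norm_lborel_Icc:
  fixes h :: "real \<Rightarrow> real"
  assumes h: "continuous_on {a..b} h" and a: "0 \<le> a"
    and v: "\<And>x :: 'a::euclidean_space. g x = (if norm x \<in> {a..b} then h (norm x) else 0)"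
  shows "(LINT x|lborel. g x) =
    unit_ball_vol DIM('a) * DIM('a) * integral {a..b} (\<lambda>r. r ^ (DIM('a) - 1) * h r)"
proof -
  let ?h = "\<lambda>r. indicator {a..b} r *\<^sub>R h r"
  have [measurable]: "?h \<in> borel_measurable borel"
    by (rule borel_measurable_continuous_on_indicator[OF _ h]) simp
  have "(LINT x|lborel. g x) = (LINT x|(lborel :: 'a measure). ?h (norm x))"
    by (intro Bochner_Integration.integral_cong) (auto simp: v indicator_def)
  also have "\<dots> = unit_ball_vol DIM('a) * DIM('a) * (LINT r|lborel. indicator {0..} r * (r ^ (DIM('a) - 1) * ?h r))"
    by (rule integral_norm_lborel) fact
  also have "(LINT r|lborel. indicator {0..} r * (r ^ (DIM('a) - 1) * ?h r)) = (LINT r:{a..b}|lborel. r ^ (DIM('a) - 1) * h r)"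
    unfolding set_lebesgue_integral_def
    using a by (intro Bochner_Integration.integral_cong) (auto simp: indicator_def)
  also have "\<dots> = integral {a..b} (\<lambda>r. r ^ (DIM('a) - 1) * h r)"
    by (intro set_borel_integral_eq_integral borel_integrable_atLeastAtMost' continuous_intros h)
  finally show ?thesis .
qed

section \<open>The weighted Hardy inequality on an interval\<close>

lemma has_real_derivative_abs_powr:
  fixes p y :: real
  assumes "p > 1"
  shows "((\<lambda>y. \<bar>y\<bar> powr p) has_real_derivative p * \<bar>y\<bar> powr (p - 1) * sgn y) (at y)"
proof (cases "y = 0")
  case True
  \<comment> \<open>This is the difference quotient at 0; it tends to 0 because
    \<open>p > 1\<close>.\<close>
  have "((\<lambda>x. \<bar>x\<bar> powr (p - 1) * sgn x) \<longlongrightarrow> 0) (at (0::real))"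
  proof (rule Lim_null_comparison)
    show "eventually (\<lambda>x. norm (\<bar>x\<bar> powr (p - 1) * sgn x) \<le> \<bar>x\<bar> powr (p - 1)) (at (0::real))"
      by (auto simp: abs_mult sgn_if)
    have "((\<lambda>x. \<bar>x\<bar> powr (p - 1)) \<longlongrightarrow> \<bar>0\<bar> powr (p - 1)) (at (0::real))"
      using assms by (intro tendsto_powr' tendsto_intros) auto
    then show "((\<lambda>x. \<bar>x\<bar> powr (p - 1)) \<longlongrightarrow> 0) (at (0::real))" by simp
  qed
  moreover have "(\<bar>x\<bar> powr p - \<bar>0\<bar> powr p) / (x - 0) = \<bar>x\<bar> powr (p - 1) * sgn x" if "x \<noteq> 0" for x :: real
    using that powr_mult_base[of "\<bar>x\<bar>" "p - 1"] by (auto simp: sgn_if abs_if field_simps)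
  then have "eventually (\<lambda>x. \<bar>x\<bar> powr (p - 1) * sgn x = (\<bar>x\<bar> powr p - \<bar>0\<bar> powr p) / (x - 0)) (at (0::real))"
    by (auto simp: eventually_at_filter)
  ultimately have "((\<lambda>x. (\<bar>x\<bar> powr p - \<bar>0\<bar> powr p) / (x - 0)) \<longlongrightarrow> 0) (at (0::real))"
    by (rule Lim_transform_eventually)
  then show ?thesis
    using True by (simp add: has_field_derivative_iff)
next
  case False
  then have "(abs has_real_derivative sgn y) (at y)"
    using has_derivative_norm[of y]
    by (simp add: has_field_derivative_def inner_real_def real_norm_def[abs_def] mult_commute_abs)
  moreover have "((\<lambda>z. z powr p) has_real_derivative p * \<bar>y\<bar> powr (p - 1)) (at \<bar>y\<bar>)"
    using False by (auto intro!: derivative_eq_intros)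
  ultimately show ?thesis
    using DERIV_chain2[of "\<lambda>z. z powr p" _ abs y "sgn y"] by blast
qed

lemma continuous_on_abs_powr [continuous_intros]:
  fixes f :: "'a::topological_space \<Rightarrow> real"
  assumes "continuous_on S f" "p > 0"
  shows "continuous_on S (\<lambda>x. \<bar>f x\<bar> powr p)"
  using assms by (intro continuous_on_powr' continuous_intros) auto

text \<open>The graph of a convex function lies above its tangent at \<open>y\<close>. Here this is
  Young's inequality for \<open>\<bar>x\<bar>\<close> and \<open>\<bar>y\<bar> powr (p - 1)\<close>,
  whose power with the conjugate exponent \<open>q\<close> is
  \<open>\<bar>y\<bar> powr p\<close>.\<close>

lemma abs_powr_ge_tangent:
  fixes p x y :: real
  assumes "p > 1"
  shows "\<bar>y\<bar> powr p + p * (\<bar>y\<bar> powr (p - 1) * sgn y) * (x - y) \<le> \<bar>x\<bar> powr p"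
proof -
  define q where "q = p / (p - 1)"
  have q: "q > 1" "1 / p + 1 / q = 1"
    using assms by (auto simp: q_def field_simps)
  have "\<bar>x\<bar> * \<bar>y\<bar> powr (p - 1) \<le> \<bar>x\<bar> powr p / p + (\<bar>y\<bar> powr (p - 1)) powr q / q"
    using assms q by (intro Youngs_inequality) auto
  also have "(\<bar>y\<bar> powr (p - 1)) powr q = \<bar>y\<bar> powr p"
    using assms by (simp add: powr_powr q_def)
  finally have "p * (\<bar>x\<bar> * \<bar>y\<bar> powr (p - 1)) \<le> p * (\<bar>x\<bar> powr p / p + \<bar>y\<bar> powr p / q)"
    using assms by (intro mult_left_mono) auto
  also have "\<dots> = \<bar>x\<bar> powr p + (p - 1) * \<bar>y\<bar> powr p"
    using assms by (simp add: q_def field_simps)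
  finally have 1: "p * (\<bar>x\<bar> * \<bar>y\<bar> powr (p - 1)) \<le> \<bar>x\<bar> powr p + (p - 1) * \<bar>y\<bar> powr p" .
  have 2: "\<bar>y\<bar> powr (p - 1) * sgn y * y = \<bar>y\<bar> powr p"
    using powr_mult_base[of "\<bar>y\<bar>" "p - 1"] by (auto simp: sgn_if abs_if field_simps)
  have "sgn y * x \<le> \<bar>x\<bar>" by (auto simp: sgn_if)
  then have "p * (\<bar>y\<bar> powr (p - 1) * (sgn y * x)) \<le> p * (\<bar>y\<bar> powr (p - 1) * \<bar>x\<bar>)"
    using assms by (intro mult_left_mono) auto
  then have "p * (\<bar>y\<bar> powr (p - 1) * sgn y) * x \<le> p * (\<bar>x\<bar> * \<bar>y\<bar> powr (p - 1))"
    by (simp add: mult_ac)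
  with 1 2 show ?thesis
    by (simp add: algebra_simps)
qed

lemma hardy_Icc:
  fixes w w' :: "real \<Rightarrow> real"
  assumes p: "p > 1" and ab: "0 < a" "a \<le> b"
    and der: "\<And>r. r \<in> {a..b} \<Longrightarrow> (w has_real_derivative w' r) (at r)"
    and cont: "continuous_on {a..b} w'"
    and bdry: "w a = 0" "w b = 0"
  shows "\<bar>(\<beta> + 1) / p - 1\<bar> powr p * integral {a..b} (\<lambda>r. r powr (\<beta> - p) * \<bar>w r\<bar> powr p)
         \<le> integral {a..b} (\<lambda>r. r powr \<beta> * \<bar>w' r\<bar> powr p)"
proof -
  \<comment> \<open>This value makes \<open>\<beta> - p + 1 = p * \<kappa>\<close>, so that
    differentiating \<open>r powr (\<beta> - p + 1) * \<bar>w r\<bar> powr p\<close> yields the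
    factor \<open>r * w' r + \<kappa> * w r\<close>, which is A - B.\<close>
  define \<kappa> where "\<kappa> = (\<beta> + 1) / p - 1"
  define s where "s = (\<lambda>y::real. \<bar>y\<bar> powr (p - 1) * sgn y)"
  define E where "E = (\<lambda>r. s \<kappa> * (r powr (\<beta> - p + 1) * \<bar>w r\<bar> powr p))"
  \<comment> \<open>Up to sign this is the weight \<open>r powr (\<beta> - p)\<close> times the
    linear term of the tangent inequality; the sign comes from B having the factor
    \<open>- \<kappa>\<close>.\<close>
  define E' where "E' = (\<lambda>r. s \<kappa> * p * (r powr (\<beta> - p) * s (w r) * (r * w' r + \<kappa> * w r)))"
  have cw: "continuous_on {a..b} w"
    using der by (meson DERIV_continuous_on has_field_derivative_at_within)
  have \<kappa>: "\<beta> - p + 1 = p * \<kappa>"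
    using p by (simp add: \<kappa>_def field_simps)
  have derE: "(E has_real_derivative E' r) (at r)" if r: "r \<in> {a..b}" for r
  proof -
    have r0: "r > 0" using r ab by auto
    have 1: "((\<lambda>r. \<bar>w r\<bar> powr p) has_real_derivative (p * \<bar>w r\<bar> powr (p - 1) * sgn (w r)) * w' r) (at r)"
      using DERIV_chain2[OF has_real_derivative_abs_powr[OF p] der[OF r]] .
    have 2: "((\<lambda>r. r powr (\<beta> - p + 1)) has_real_derivative (\<beta> - p + 1) * r powr (\<beta> - p)) (at r)"
      using r0 by (auto intro!: derivative_eq_intros)
    have 3: "(E has_real_derivative s \<kappa> * ((\<beta> - p + 1) * r powr (\<beta> - p) * \<bar>w r\<bar> powr p
       + ((p * \<bar>w r\<bar> powr (p - 1) * sgn (w r)) * w' r) * r powr (\<beta> - p + 1))) (at r)"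
      unfolding E_def by (intro DERIV_cmult DERIV_mult 1 2)
    have 4: "\<bar>w r\<bar> powr p = s (w r) * w r"
      using powr_mult_base[of "\<bar>w r\<bar>" "p - 1"] by (auto simp: s_def sgn_if abs_if field_simps)
    have 5: "r powr (\<beta> - p + 1) = r * r powr (\<beta> - p)"
      using r0 by (simp add: powr_add)
    have "s \<kappa> * ((\<beta> - p + 1) * r powr (\<beta> - p) * \<bar>w r\<bar> powr p
       + ((p * \<bar>w r\<bar> powr (p - 1) * sgn (w r)) * w' r) * r powr (\<beta> - p + 1))
       = s \<kappa> * (p * \<kappa> * r powr (\<beta> - p) * (s (w r) * w r) + p * s (w r) * w' r * (r * r powr (\<beta> - p)))"
      unfolding 5 4 by (simp add: \<kappa> s_def)
    also have "\<dots> = E' r"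
      by (simp add: E'_def algebra_simps)
    finally show ?thesis
      using 3 by simp
  qed
  have "(E' has_integral E b - E a) {a..b}"
    using ab derE by (intro fundamental_theorem_of_calculus)
      (auto simp: has_real_derivative_iff_has_vector_derivative[symmetric] intro: has_field_derivative_at_within)
  then have IE: "(E' has_integral 0) {a..b}"
    using bdry p by (simp add: E_def)
  have pos: "r \<noteq> 0" if "r \<in> {a..b}" for r using that ab by auto
  have I1: "(\<lambda>r. r powr (\<beta> - p) * \<bar>w r\<bar> powr p) integrable_on {a..b}"
    using p pos by (intro integrable_continuous_real continuous_intros cw) auto
  have I2: "(\<lambda>r. r powr \<beta> * \<bar>w' r\<bar> powr p) integrable_on {a..b}"
    using p pos by (intro integrable_continuous_real continuous_intros cont) auto
  have "integral {a..b} (\<lambda>r. \<bar>\<kappa>\<bar> powr p * (r powr (\<beta> - p) * \<bar>w r\<bar> powr p) - E' r)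
        \<le> integral {a..b} (\<lambda>r. r powr \<beta> * \<bar>w' r\<bar> powr p)"
  proof (rule integral_le)
    show "(\<lambda>r. \<bar>\<kappa>\<bar> powr p * (r powr (\<beta> - p) * \<bar>w r\<bar> powr p) - E' r) integrable_on {a..b}"
      using IE by (intro integrable_diff integrable_on_mult_right I1) auto
    fix r assume r: "r \<in> {a..b}"
    then have r0: "r > 0" using ab by auto
    have "s (- \<kappa> * w r) = - (s \<kappa> * s (w r))"
      by (simp add: s_def abs_mult powr_mult sgn_mult)
    then have *: "\<bar>\<kappa> * w r\<bar> powr p - p * (s \<kappa> * s (w r)) * (r * w' r + \<kappa> * w r) \<le> \<bar>r * w' r\<bar> powr p"
      using abs_powr_ge_tangent[OF p, of "- \<kappa> * w r" "r * w' r"] by (simp add: s_def)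
    have "\<bar>\<kappa>\<bar> powr p * (r powr (\<beta> - p) * \<bar>w r\<bar> powr p) - E' r
       = r powr (\<beta> - p) * (\<bar>\<kappa> * w r\<bar> powr p - p * (s \<kappa> * s (w r)) * (r * w' r + \<kappa> * w r))"
      by (simp add: E'_def abs_mult powr_mult algebra_simps)
    also have "\<dots> \<le> r powr (\<beta> - p) * \<bar>r * w' r\<bar> powr p"
      by (intro mult_left_mono *) auto
    also have "\<dots> = r powr \<beta> * \<bar>w' r\<bar> powr p"
      using r0 by (simp add: abs_mult powr_mult powr_diff)
    finally show "\<bar>\<kappa>\<bar> powr p * (r powr (\<beta> - p) * \<bar>w r\<bar> powr p) - E' r \<le> r powr \<beta> * \<bar>w' r\<bar> powr p" .
  qed (use I2 in auto)
  also have "integral {a..b} (\<lambda>r. \<bar>\<kappa>\<bar> powr p * (r powr (\<beta> - p) * \<bar>w r\<bar> powr p) - E' r)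
    = \<bar>\<kappa>\<bar> powr p * integral {a..b} (\<lambda>r. r powr (\<beta> - p) * \<bar>w r\<bar> powr p) - integral {a..b} E'"
    using IE I1 by (subst Henstock_Kurzweil_Integration.integral_diff) (auto intro: integrable_on_mult_right)
  finally show ?thesis
    using IE by (simp add: \<kappa>_def integral_unique)
qed

section \<open>Calculus of radial functions\<close>

text \<open>\<open>deriv\<close> is total, so \<open>partial\<close> is a genuine derivative only
  where one exists; total differentiability supplies it.\<close>

lemma has_real_derivative_partial:
  assumes "f differentiable (at x)"
  shows "((\<lambda>t. f (x + t *\<^sub>R axis i 1)) has_real_derivative partial i f x) (at 0)"
proof -
  have "((\<lambda>t. x + t *\<^sub>R axis i 1) has_derivative (\<lambda>t. t *\<^sub>R axis i 1)) (at (0::real))"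
    by (auto intro!: derivative_eq_intros)
  then have "(\<lambda>t. x + t *\<^sub>R axis i 1) differentiable (at (0::real))"
    unfolding differentiable_def by blast
  then have "(f \<circ> (\<lambda>t. x + t *\<^sub>R axis i 1)) differentiable (at (0::real))"
    using assms by (intro differentiable_chain_at) auto
  then show ?thesis
    unfolding partial_def by (simp add: o_def DERIV_deriv_iff_real_differentiable)
qed

lemma partial_eqI:
  "((\<lambda>t. f (x + t *\<^sub>R axis i 1)) has_real_derivative D) (at 0) \<Longrightarrow> partial i f x = D"
  unfolding partial_def by (rule DERIV_imp_deriv)

lemma partial_has_derivative:
  assumes "(f has_derivative D) (at x)"
  shows "partial i f x = D (axis i 1)"
proof (rule partial_eqI)
  have "((\<lambda>t. x + t *\<^sub>R axis i 1) has_derivative (\<lambda>t. t *\<^sub>R axis i 1)) (at (0::real))"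
    by (auto intro!: derivative_eq_intros)
  moreover have "(f has_derivative D) (at (x + 0 *\<^sub>R axis i 1))"
    using assms by simp
  ultimately have "((\<lambda>t. f (x + t *\<^sub>R axis i 1)) has_derivative (\<lambda>t. D (t *\<^sub>R axis i 1))) (at 0)"
    by (rule has_derivative_compose)
  moreover have "D (t *\<^sub>R axis i 1) = D (axis i 1) * t" for t
    using has_derivative_bounded_linear[OF assms] bounded_linear.linear linear_cmul by fastforce
  ultimately show "((\<lambda>t. f (x + t *\<^sub>R axis i 1)) has_real_derivative D (axis i 1)) (at 0)"
    by (simp add: has_field_derivative_def)
qed

lemma partial_cong:
  assumes "open S" "x \<in> S" and eq: "\<And>y. y \<in> S \<Longrightarrow> f y = g y"
  shows "partial i f x = partial i g x"
proof -
  have "((\<lambda>t. x + t *\<^sub>R axis i 1) \<longlongrightarrow> x + 0 *\<^sub>R axis i 1) (nhds (0::real))"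
    by (intro tendsto_intros filterlim_ident)
  then have "eventually (\<lambda>t. x + t *\<^sub>R axis i 1 \<in> S) (nhds (0::real))"
    using assms(1,2) by (auto dest!: topological_tendstoD)
  then have "eventually (\<lambda>t. f (x + t *\<^sub>R axis i 1) = g (x + t *\<^sub>R axis i 1)) (nhds (0::real))"
    by (rule eventually_mono) (rule eq)
  then show ?thesis
    unfolding partial_def by (rule deriv_cong_ev) simp
qed

lemma partial_eq_0:
  "open S \<Longrightarrow> x \<in> S \<Longrightarrow> (\<And>y. y \<in> S \<Longrightarrow> f y = 0) \<Longrightarrow> partial i f x = 0"
  using partial_cong[of S x f "\<lambda>_. 0" i] by (simp add: partial_def)

lemma laplacian_eq_0:
  assumes "open S" "x \<in> S" "\<And>y. y \<in> S \<Longrightarrow> f y = 0"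
  shows "laplacian f x = 0"
proof -
  have "partial i f y = 0" if "y \<in> S" for i y
    using partial_eq_0[of S y f] assms that by blast
  then have "partial i (partial i f) x = 0" for i
    using partial_eq_0[of S x "partial i f"] assms by blast
  then show ?thesis by (simp add: laplacian_def)
qed

lemma partial_add:
  assumes "f differentiable (at x)" "g differentiable (at x)"
  shows "partial i (\<lambda>x. f x + g x) x = partial i f x + partial i g x"
  by (intro partial_eqI DERIV_add has_real_derivative_partial assms)

lemma partial_mult:
  assumes "f differentiable (at x)" "g differentiable (at x)"
  shows "partial i (\<lambda>x. f x * g x) x = partial i f x * g x + f x * partial i g x"
  using DERIV_mult[OF has_real_derivative_partial[OF assms(1), of i] has_real_derivative_partial[OF assms(2), of i]]
  by (intro partial_eqI) (simp add: algebra_simps)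

text \<open>On an open set, partial derivatives depend only on values inside the set. Hence formulas
  for \<open>partial i f\<close> that are valid only on \<open>S\<close>, such as the product rule,
  may be substituted under \<open>Ck_on\<close>.\<close>

lemma Ck_on_cong:
  assumes "open S" "\<And>x. x \<in> S \<Longrightarrow> f x = g x" "Ck_on k S f"
  shows "Ck_on k S g"
  using assms(2,3)
proof (induction k arbitrary: f g)
  case 0
  then show ?case by (simp add: continuous_on_eq)
next
  case (Suc k)
  have "g differentiable (at x)" if "x \<in> S" for x
  proof -
    from Suc.prems that obtain D where "(f has_derivative D) (at x)"
      by (auto simp: differentiable_def)
    then have "(g has_derivative D) (at x)"
      by (rule has_derivative_transform_within_open) (use assms(1) that Suc.prems in auto)
    then show ?thesis by (auto simp: differentiable_def)
  qed
  moreover have "Ck_on k S (partial i g)" for i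
  proof (rule Suc.IH)
    show "partial i f x = partial i g x" if "x \<in> S" for x
      using Suc.prems(1) by (rule partial_cong[OF assms(1) that])
    show "Ck_on k S (partial i f)"
      using Suc.prems by simp
  qed
  ultimately show ?case by simp
qed

lemma Ck_on_imp_continuous_on: "Ck_on k S f \<Longrightarrow> continuous_on S f"
  by (cases k) (auto intro!: differentiable_imp_continuous_on differentiable_at_imp_differentiable_on)

lemma Ck_on_Suc_imp: "Ck_on (Suc k) S f \<Longrightarrow> Ck_on k S f"
proof (induction k arbitrary: f)
  case 0
  then show ?case using Ck_on_imp_continuous_on by fastforce
next
  case (Suc k)
  then show ?case by auto
qed

lemma Ck_on_mono: "Ck_on k S f \<Longrightarrow> j \<le> k \<Longrightarrow> Ck_on j S f"
  by (induction k arbitrary: j) (auto simp: le_Suc_eq simp del: Ck_on.simps(2) dest: Ck_on_Suc_imp)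

lemma Ck_on_const: "Ck_on k S (\<lambda>_. c)"
proof (induction k arbitrary: c)
  case (Suc k)
  have "partial i (\<lambda>_. c) = (\<lambda>_. 0)" for i :: 'a
    by (auto simp: partial_def)
  then show ?case using Suc by auto
qed auto

lemma Ck_on_add:
  assumes "open S" "Ck_on k S f" "Ck_on k S g"
  shows "Ck_on k S (\<lambda>x. f x + g x)"
  using assms(2,3)
proof (induction k arbitrary: f g)
  case 0
  then show ?case by (auto intro: continuous_intros)
next
  case (Suc k)
  have "Ck_on k S (partial i (\<lambda>x. f x + g x))" for i
    using Suc.prems
    by (intro Ck_on_cong[OF assms(1) partial_add[symmetric] Suc.IH]) auto
  then show ?case using Suc.prems by auto
qed

lemma Ck_on_sum:
  assumes "open S" "\<And>i. i \<in> A \<Longrightarrow> Ck_on k S (f i)"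
  shows "Ck_on k S (\<lambda>x. \<Sum>i\<in>A. f i x)"
  using assms(2)
  by (induction A rule: infinite_finite_induct) (auto intro: Ck_on_const Ck_on_add assms(1))

lemma Ck_on_mult:
  assumes "open S" "Ck_on k S f" "Ck_on k S g"
  shows "Ck_on k S (\<lambda>x. f x * g x)"
  using assms(2,3)
proof (induction k arbitrary: f g)
  case 0
  then show ?case by (auto intro: continuous_intros)
next
  case (Suc k)
  \<comment> \<open>The product rule leaves one factor undifferentiated in each summand, so both
    factors are also needed at the lower order \<open>k\<close>.\<close>
  have "Ck_on k S (partial i (\<lambda>x. f x * g x))" for i
    using Suc.prems Ck_on_Suc_imp[OF Suc.prems(1)] Ck_on_Suc_imp[OF Suc.prems(2)]
    by (intro Ck_on_cong[OF assms(1) partial_mult[symmetric] Ck_on_add[OF assms(1) Suc.IH Suc.IH]]) auto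
  then show ?case using Suc.prems by auto
qed

lemma has_derivative_component:
  "((\<lambda>x :: real^'n. x $ i) has_derivative (\<lambda>x. x $ i)) (at x)"
  by (intro bounded_linear_imp_has_derivative bounded_linear_vec_nth)

lemma partial_component: "partial j (\<lambda>x. x $ i) x = (if j = i then 1 else 0)"
  using partial_has_derivative[OF has_derivative_component, of j i x] by (auto simp: axis_def)

lemma Ck_on_component: "Ck_on k S (\<lambda>x. x $ i)"
proof (cases k)
  case 0
  then show ?thesis by (auto intro!: continuous_intros)
next
  case (Suc l)
  have "partial j (\<lambda>x. x $ i) = (\<lambda>_. if j = i then 1 else 0)" for j :: 'a
    by (intro ext partial_component)
  then show ?thesis
    using has_derivative_component by (auto simp: Suc Ck_on_const differentiable_def)
qed

lemma Ck_on_laplacian: "Ck_on (Suc (Suc k)) S f \<Longrightarrow> open S \<Longrightarrow> Ck_on k S (laplacian f)"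
  unfolding laplacian_def[abs_def] by (intro Ck_on_sum) auto

section \<open>Gradient, Laplacian and one-dimensional profile of radial functions\<close>

lemma has_derivative_radial:
  fixes x :: "real^'n"
  assumes "(h has_real_derivative h') (at (norm x))" "x \<noteq> 0"
  shows "((\<lambda>x. h (norm x)) has_derivative (\<lambda>y. h' / norm x * (x \<bullet> y))) (at x)"
proof -
  have "((\<lambda>x. norm x) has_derivative (\<lambda>y. y \<bullet> sgn x)) (at x)"
    using has_derivative_norm[OF assms(2)] by (simp add: inner_commute)
  then have "((\<lambda>x. h (norm x)) has_derivative (\<lambda>y. (y \<bullet> sgn x) * h')) (at x)"
    by (rule has_derivative_compose)
       (use assms(1) in \<open>simp add: has_field_derivative_def mult_commute_abs\<close>)
  then show ?thesis
    by (rule has_derivative_eq_rhs) (auto simp: sgn_div_norm inner_commute field_simps)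
qed

lemma partial_radial:
  fixes x :: "real^'n"
  assumes "(h has_real_derivative h') (at (norm x))" "x \<noteq> 0"
  shows "partial i (\<lambda>x. h (norm x)) x = h' / norm x * x $ i"
  using partial_has_derivative[OF has_derivative_radial[OF assms]] by (simp add: inner_axis)

lemma norm_grad_radial:
  fixes x :: "real^'n"
  assumes "(h has_real_derivative h') (at (norm x))" "x \<noteq> 0"
  shows "norm (grad (\<lambda>x. h (norm x)) x) = \<bar>h'\<bar>"
proof -
  have "grad (\<lambda>x. h (norm x)) x = (h' / norm x) *\<^sub>R x"
    by (simp add: grad_def partial_radial[OF assms] vec_eq_iff)
  then show ?thesis using assms(2) by simp
qed

lemma laplacian_radial:
  fixes x :: "real^'n"
  assumes h: "\<And>r. r > 0 \<Longrightarrow> (h has_real_derivative h' r) (at r)"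
    and h': "(h' has_real_derivative h'') (at (norm x))" and x: "x \<noteq> 0"
  shows "laplacian (\<lambda>x. h (norm x)) x = h'' + (real CARD('n) - 1) / norm x * h' (norm x)"
proof -
  \<comment> \<open>The derivative of \<open>h' r / r\<close>, the factor that multiplies
    \<open>x $ i\<close> in the first partial derivative. In the sum over \<open>i\<close> it meets
    the squared coordinates, which add up to the square of the norm.\<close>
  define D where "D = h'' / norm x - h' (norm x) / (norm x)\<^sup>2"
  have dg: "((\<lambda>r. h' r / r) has_real_derivative D) (at (norm x))"
    using h' x by (auto intro!: derivative_eq_intros simp: D_def power2_eq_square field_simps)
  have "partial i (partial i (\<lambda>x. h (norm x))) x = D / norm x * (x $ i)\<^sup>2 + h' (norm x) / norm x" for i :: 'n
  proof -
    have "partial i (partial i (\<lambda>x. h (norm x))) x = partial i (\<lambda>x. h' (norm x) / norm x * x $ i) x"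
      using x by (intro partial_cong[of "- {0}"]) (auto simp: partial_radial[OF h])
    also have "\<dots> = D / norm x * x $ i * x $ i + h' (norm x) / norm x * partial i (\<lambda>x. x $ i) x"
      using has_derivative_radial[OF dg x] has_derivative_component
      by (subst partial_mult) (auto simp: partial_radial[OF dg x] differentiable_def)
    also have "partial i (\<lambda>x. x $ i) x = 1"
      by (simp add: partial_component)
    finally show ?thesis by (simp add: power2_eq_square)
  qed
  then have "laplacian (\<lambda>x. h (norm x)) x = D / norm x * (\<Sum>i\<in>UNIV. (x $ i)\<^sup>2) + CARD('n) * (h' (norm x) / norm x)"
    by (simp add: laplacian_def sum.distrib sum_distrib_left)
  also have "(\<Sum>i\<in>UNIV. (x $ i)\<^sup>2) = (norm x)\<^sup>2"
    by (simp add: norm_vec_def L2_set_def sum_nonneg)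
  also have "D / norm x * (norm x)\<^sup>2 = h'' - h' (norm x) / norm x"
    using x by (simp add: D_def power2_eq_square left_diff_distrib, simp add: diff_divide_distrib)
  finally show ?thesis
    using x by (simp add: diff_divide_distrib left_diff_distrib)
qed

lemma has_real_derivative_along_axis:
  assumes "g differentiable (at (r *\<^sub>R axis i 1))"
  shows "((\<lambda>r. g (r *\<^sub>R axis i 1)) has_real_derivative partial i g (r *\<^sub>R axis i 1)) (at r)"
proof -
  have "((\<lambda>t. g ((t + r) *\<^sub>R axis i 1)) has_real_derivative partial i g (r *\<^sub>R axis i 1)) (at 0)"
    using has_real_derivative_partial[OF assms, of i] by (simp add: scaleR_add_left add.commute)
  then show ?thesis
    using DERIV_shift[of "\<lambda>r. g (r *\<^sub>R axis i 1)" _ 0 r] by simp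
qed

text \<open>The profile is the restriction of \<open>v\<close> to a ray along a coordinate axis,
  where its derivatives are iterated partial derivatives of \<open>v\<close> in that one
  direction.\<close>

lemma radial_profile:
  fixes v :: "real^'n \<Rightarrow> real"
  assumes C2: "Ck_on (Suc (Suc 0)) (UNIV - {0}) v" and rad: "radially_symmetric v"
  obtains f f' f'' :: "real \<Rightarrow> real" where
    "v = (\<lambda>x. f (norm x))"
    "\<And>r. r > 0 \<Longrightarrow> (f has_real_derivative f' r) (at r)"
    "\<And>r. r > 0 \<Longrightarrow> (f' has_real_derivative f'' r) (at r)"
    "continuous_on {0<..} f''"
proof -
  define i :: 'n where "i = undefined"
  define e :: "real^'n" where "e = axis i 1"
  have ne: "norm e = 1" by (simp add: e_def)
  show ?thesis
  proof
    show "v = (\<lambda>x. v (norm x *\<^sub>R e))"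
    proof
      fix x :: "real^'n"
      have "norm x = norm (norm x *\<^sub>R e)" using ne by simp
      then show "v x = v (norm x *\<^sub>R e)"
        using rad unfolding radially_symmetric_def by blast
    qed
    show "((\<lambda>r. v (r *\<^sub>R e)) has_real_derivative partial i v (r *\<^sub>R e)) (at r)" if "r > 0" for r
      unfolding e_def by (rule has_real_derivative_along_axis) (use C2 that in \<open>auto simp: axis_eq_0_iff\<close>)
    show "((\<lambda>r. partial i v (r *\<^sub>R e)) has_real_derivative partial i (partial i v) (r *\<^sub>R e)) (at r)" if "r > 0" for r
      unfolding e_def by (rule has_real_derivative_along_axis) (use C2 that in \<open>auto simp: axis_eq_0_iff\<close>)
    show "continuous_on {0<..} (\<lambda>r. partial i (partial i v) (r *\<^sub>R e))"
      by (rule continuous_on_compose2[of "UNIV - {0}" "partial i (partial i v)"])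
         (use C2 ne in \<open>auto intro!: continuous_intros\<close>)
  qed
qed

text \<open>The radii are explicit because they survive the Laplacian unchanged while the order of
  smoothness drops by two, which suits induction on the number of Laplacians.\<close>

definition radial_on_annulus :: "nat \<Rightarrow> real \<Rightarrow> real \<Rightarrow> (real^'n::finite \<Rightarrow> real) \<Rightarrow> bool" where
  "radial_on_annulus k a b v \<longleftrightarrow> Ck_on k (UNIV - {0}) v \<and> radially_symmetric v \<and>
     (\<forall>x. v x \<noteq> 0 \<longrightarrow> a \<le> norm x \<and> norm x \<le> b)"

lemma Ccr_punctured_imp_radial_on_annulus:
  assumes "u \<in> Ccr_punctured k"
  obtains a b where "0 < a" "radial_on_annulus k a b u"
proof -
  let ?S = "closure {x. u x \<noteq> 0}"
  have u: "Ck_on k (UNIV - {0}) u" "radially_symmetric u" "compact ?S" "0 \<in> - ?S"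
    using assms by (auto simp: Ccr_punctured_def)
  from u(3) obtain b where b: "\<And>x. x \<in> ?S \<Longrightarrow> norm x \<le> b"
    by (meson compact_imp_bounded bounded_iff)
  have "open (- ?S)" by (intro open_Compl closed_closure)
  with u(4) obtain a where a: "a > 0" "ball 0 a \<subseteq> - ?S"
    using open_contains_ball by blast
  have "a \<le> norm x \<and> norm x \<le> b" if "u x \<noteq> 0" for x
  proof -
    have "x \<in> ?S"
      using that closure_subset[of "{x. u x \<noteq> 0}"] by auto
    then have "x \<notin> ball 0 a" "norm x \<le> b"
      using a(2) b by auto
    then show ?thesis by auto
  qed
  with u a(1) show ?thesis
    by (intro that[of a b]) (auto simp: radial_on_annulus_def)
qed

lemma Ccr_puncturedI:
  assumes "0 < a" "radial_on_annulus k a b u"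
  shows "u \<in> Ccr_punctured k"
proof -
  have sub: "closure {x. u x \<noteq> 0} \<subseteq> cball 0 b - ball 0 a"
    by (rule closure_minimal) (use assms in \<open>auto simp: radial_on_annulus_def\<close>)
  then have "compact (closure {x. u x \<noteq> 0})"
    by (meson bounded_cball bounded_closure_image bounded_subset closed_closure compact_eq_bounded_closed Diff_subset subset_trans)
  with sub show ?thesis
    using assms by (auto simp: Ccr_punctured_def radial_on_annulus_def)
qed

text \<open>The complement of the closed annulus is open, so \<open>v\<close> vanishes around
  \<open>x\<close> and not just at it; this makes the derivatives at \<open>x\<close> vanish
  too.\<close>

lemma annulus_complement:
  assumes "radial_on_annulus k a b v" "\<not> (a \<le> norm x \<and> norm x \<le> b)"
  shows "\<exists>S. open S \<and> x \<in> S \<and> (\<forall>y\<in>S. v y = 0)"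
  using assms
  by (intro exI[of _ "ball 0 a \<union> - cball 0 b"]) (auto simp: radial_on_annulus_def)

lemma radial_on_annulus_laplacian:
  assumes "radial_on_annulus (Suc (Suc k)) a b v" "0 < a"
  shows "radial_on_annulus k a b (laplacian v)"
  unfolding radial_on_annulus_def
proof (intro conjI allI)
  have v: "Ck_on (Suc (Suc k)) (UNIV - {0}) v" "radially_symmetric v"
    using assms by (auto simp: radial_on_annulus_def)
  show "Ck_on k (UNIV - {0}) (laplacian v)"
    using Ck_on_laplacian[OF v(1)] by (simp add: open_delete)
  have "Ck_on (Suc (Suc 0)) (UNIV - {0}) v"
    using v(1) by (rule Ck_on_mono) simp
  from this v(2) obtain f f' f'' where f: "v = (\<lambda>x. f (norm x))"
    "\<And>r. r > 0 \<Longrightarrow> (f has_real_derivative f' r) (at r)"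
    "\<And>r. r > 0 \<Longrightarrow> (f' has_real_derivative f'' r) (at r)"
    "continuous_on {0<..} f''"
    by (rule radial_profile) metis
  have L: "laplacian v x = f'' (norm x) + (real CARD('a) - 1) / norm x * f' (norm x)" if "x \<noteq> 0" for x
    unfolding f(1) using that by (intro laplacian_radial f) auto
  show "radially_symmetric (laplacian v)"
    unfolding radially_symmetric_def
  proof (intro allI impI)
    fix x y :: "real^'a" assume eq: "norm x = norm y"
    show "laplacian v x = laplacian v y"
    proof (cases "x = 0")
      case False
      then have "y \<noteq> 0" using eq by auto
      then show ?thesis using False eq by (simp add: L)
    qed (use eq in auto)
  qed
  fix x
  show "laplacian v x \<noteq> 0 \<longrightarrow> a \<le> norm x \<and> norm x \<le> b"
    using annulus_complement[OF assms(1)] laplacian_eq_0 by metis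
qed

lemma radial_on_annulus_laplacian_iterate:
  assumes "radial_on_annulus (2 * j + k) a b v" "0 < a"
  shows "radial_on_annulus k a b ((laplacian ^^ j) v)"
  using assms
proof (induction j arbitrary: k)
  case (Suc j)
  then have "radial_on_annulus (2 * j + Suc (Suc k)) a b v" by simp
  from Suc.IH[OF this] show ?case
    using radial_on_annulus_laplacian Suc.prems by auto
qed auto

lemma hardy_radial:
  fixes v :: "real^'n \<Rightarrow> real"
  assumes v: "radial_on_annulus (Suc (Suc 0)) a b v" and a: "0 < a" and p: "p > 1"
  shows "\<bar>real CARD('n) - (real CARD('n) + \<alpha>) / p\<bar> powr p *
           (LINT x|lborel. norm x powr (\<alpha> - p) * norm (grad v x) powr p)
         \<le> (LINT x|lborel. norm x powr \<alpha> * \<bar>laplacian v x\<bar> powr p)"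
proof -
  have C2: "Ck_on (Suc (Suc 0)) (UNIV - {0}) v" and rad: "radially_symmetric v"
    using v by (auto simp: radial_on_annulus_def)
  from C2 rad obtain f f' f'' where f: "v = (\<lambda>x. f (norm x))"
    "\<And>r. r > 0 \<Longrightarrow> (f has_real_derivative f' r) (at r)"
    "\<And>r. r > 0 \<Longrightarrow> (f' has_real_derivative f'' r) (at r)"
    "continuous_on {0<..} f''"
    by (rule radial_profile) metis
  define k where "k = CARD('n) - 1"
  have n: "CARD('n) = Suc k" by (simp add: k_def)
  define L where "L = (\<lambda>r. f'' r + (real CARD('n) - 1) / r * f' r)"
  \<comment> \<open>Enlarging the interval puts both endpoints off the annulus, so \<open>f'\<close>
    vanishes there. The maximum covers \<open>b < a\<close>, which is possible when \<open>v\<close>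
    is zero.\<close>
  define A B where "A = a / 2" and "B = max a b + 1"
  have AB: "0 < A" "A < a" "A \<le> B" "b < B"
    using a by (auto simp: A_def B_def)
  have G: "norm (grad v x) = \<bar>f' (norm x)\<bar>" if "x \<noteq> 0" for x
    unfolding f(1) using that by (intro norm_grad_radial f) auto
  have Lap: "laplacian v x = L (norm x)" if "x \<noteq> 0" for x
    unfolding f(1) L_def using that by (intro laplacian_radial f) auto
  have zero: "grad v x = 0" "laplacian v x = 0" if x: "\<not> (a \<le> norm x \<and> norm x \<le> b)" for x
  proof -
    obtain S where "open S" "x \<in> S" "\<And>y. y \<in> S \<Longrightarrow> v y = 0"
      using annulus_complement[OF v x] by blast
    then show "grad v x = 0" "laplacian v x = 0"
      by (auto simp: grad_def vec_eq_iff intro!: partial_eq_0 laplacian_eq_0)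
  qed
  \<comment> \<open>A vector of length \<open>r\<close> on an axis turns the vanishing of the
    gradient into the vanishing of \<open>f'\<close>.\<close>
  have bdry: "f' r = 0" if "r > 0" "\<not> (a \<le> r \<and> r \<le> b)" for r
    using G[of "r *\<^sub>R axis undefined 1"] zero(1)[of "r *\<^sub>R axis undefined 1"] that by (auto simp: axis_eq_0_iff)
  have cf': "continuous_on {A..B} f'"
    using f(3) AB by (intro DERIV_continuous_on[where D = f'']) (auto intro: has_field_derivative_at_within)
  have cf'': "continuous_on {A..B} f''"
    using f(4) by (rule continuous_on_subset) (use AB in auto)
  have cL: "continuous_on {A..B} L"
    unfolding L_def using AB by (intro continuous_intros cf' cf'') auto
  define c where "c = unit_ball_vol (real CARD('n)) * CARD('n)"
  have c: "c \<ge> 0" by (simp add: c_def)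
  have inside: "norm x \<in> {A..B} \<Longrightarrow> x \<noteq> 0" and outside: "norm x \<notin> {A..B} \<Longrightarrow> \<not> (a \<le> norm x \<and> norm x \<le> b)"
    for x :: "real^'n"
    using AB by auto
  have DIM: "DIM(real^'n) = CARD('n)" by simp
  have I1: "(LINT x|lborel. norm x powr (\<alpha> - p) * norm (grad v x) powr p) =
    c * integral {A..B} (\<lambda>r. r ^ k * (r powr (\<alpha> - p) * \<bar>f' r\<bar> powr p))"
    unfolding c_def k_def DIM[symmetric]
  proof (rule integral_norm_lborel_Icc)
    show "continuous_on {A..B} (\<lambda>r. r powr (\<alpha> - p) * \<bar>f' r\<bar> powr p)"
      using AB p by (intro continuous_intros cf') auto
    show "norm x powr (\<alpha> - p) * norm (grad v x) powr p =
        (if norm x \<in> {A..B} then norm x powr (\<alpha> - p) * \<bar>f' (norm x)\<bar> powr p else 0)" for x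
      using G[OF inside, of x] zero(1)[OF outside, of x] by (cases "norm x \<in> {A..B}") auto
  qed (use AB in simp)
  have I2: "(LINT x|lborel. norm x powr \<alpha> * \<bar>laplacian v x\<bar> powr p) =
    c * integral {A..B} (\<lambda>r. r ^ k * (r powr \<alpha> * \<bar>L r\<bar> powr p))"
    unfolding c_def k_def DIM[symmetric]
  proof (rule integral_norm_lborel_Icc)
    show "continuous_on {A..B} (\<lambda>r. r powr \<alpha> * \<bar>L r\<bar> powr p)"
      using AB p by (intro continuous_intros cL) auto
    show "norm x powr \<alpha> * \<bar>laplacian v x\<bar> powr p =
        (if norm x \<in> {A..B} then norm x powr \<alpha> * \<bar>L (norm x)\<bar> powr p else 0)" for x
      using Lap[OF inside, of x] zero(2)[OF outside, of x] by (cases "norm x \<in> {A..B}") auto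
  qed (use AB in simp)
  \<comment> \<open>For \<open>w = r ^ k * f' r\<close> one has \<open>w' = r ^ k * L r\<close>. The
    polar weight \<open>r ^ k\<close> adds \<open>k\<close> to the exponent \<alpha>, and the factor
    \<open>r ^ k\<close> inside the \<open>p\<close>-th power takes off
    \<open>k * p\<close>.\<close>
  define \<beta> where "\<beta> = \<alpha> + real k - real k * p"
  have pw: "(r ^ k) powr p = r powr (real k * p)" if "r > 0" for r
    using that by (simp add: powr_powr flip: powr_realpow)
  have "\<bar>(\<beta> + 1) / p - 1\<bar> powr p * integral {A..B} (\<lambda>r. r powr (\<beta> - p) * \<bar>r ^ k * f' r\<bar> powr p)
         \<le> integral {A..B} (\<lambda>r. r powr \<beta> * \<bar>r ^ k * L r\<bar> powr p)"
  proof (rule hardy_Icc[OF p AB(1,3)])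
    fix r assume "r \<in> {A..B}"
    then have r: "r > 0" using AB by auto
    have "real k * r ^ (k - Suc 0) = r ^ k * (real k / r)"
      using r by (cases k) auto
    then show "((\<lambda>r. r ^ k * f' r) has_real_derivative r ^ k * L r) (at r)"
      using r f(3)[OF r] by (auto intro!: derivative_eq_intros simp: L_def n algebra_simps)
  qed (use AB in \<open>auto intro!: continuous_intros cL bdry\<close>)
  also have "integral {A..B} (\<lambda>r. r powr \<beta> * \<bar>r ^ k * L r\<bar> powr p)
    = integral {A..B} (\<lambda>r. r ^ k * (r powr \<alpha> * \<bar>L r\<bar> powr p))"
    using AB by (intro Henstock_Kurzweil_Integration.integral_cong)
      (auto simp: \<beta>_def abs_mult powr_mult pw powr_diff powr_add powr_realpow)
  also have "integral {A..B} (\<lambda>r. r powr (\<beta> - p) * \<bar>r ^ k * f' r\<bar> powr p)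
    = integral {A..B} (\<lambda>r. r ^ k * (r powr (\<alpha> - p) * \<bar>f' r\<bar> powr p))"
    using AB by (intro Henstock_Kurzweil_Integration.integral_cong)
      (auto simp: \<beta>_def abs_mult powr_mult pw powr_diff powr_add powr_realpow)
  also have "(\<beta> + 1) / p - 1 = - (real CARD('n) - (real CARD('n) + \<alpha>) / p)"
    using p by (simp add: \<beta>_def n field_simps)
  finally have "c * (\<bar>real CARD('n) - (real CARD('n) + \<alpha>) / p\<bar> powr p *
      integral {A..B} (\<lambda>r. r ^ k * (r powr (\<alpha> - p) * \<bar>f' r\<bar> powr p)))
    \<le> c * integral {A..B} (\<lambda>r. r ^ k * (r powr \<alpha> * \<bar>L r\<bar> powr p))"
    unfolding abs_minus_cancel by (rule mult_left_mono[OF _ c])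
  then show ?thesis
    unfolding I1 I2 by (simp only: mult.left_commute)
qed

section \<open>Logarithmic bump functions\<close>

text \<open>With polynomials as profiles, differentiation becomes \<open>pderiv\<close>, and
  smoothness across the ends of the interval becomes divisibility by a power of
  \<open>bump\<close>.\<close>

definition cutoff_poly :: "real poly \<Rightarrow> real \<Rightarrow> real" where
  "cutoff_poly q t = (if t \<in> {0..1} then poly q t else 0)"

text \<open>A factor \<open>bump ^ k\<close> means zeros of order at least \<open>k\<close> at both
  0 and 1; each derivative uses up one power.\<close>

definition bump :: "real poly" where
  "bump = [:0, 1, -1:]"

lemma poly_bump: "poly bump t = t * (1 - t)"
  by (simp add: bump_def algebra_simps)

lemma dvd_pderiv_of_power_dvd:
  fixes q :: "real poly"
  assumes "d ^ Suc k dvd q"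
  shows "d ^ k dvd pderiv q"
proof -
  from assms obtain h where "q = d ^ Suc k * h" by (auto elim: dvdE)
  then have "pderiv q = d ^ k * (d * pderiv h + smult (1 + of_nat k) (h * pderiv d))"
    by (simp add: pderiv_mult pderiv_power_Suc algebra_simps del: power_Suc) (simp add: algebra_simps)
  then show ?thesis by simp
qed

text \<open>Since t (1 - t) is nonnegative exactly on [0,1], the truncation can be moved into
  \<open>max 0\<close>, which is continuous.\<close>

lemma continuous_cutoff_poly:
  assumes "bump dvd q"
  shows "continuous_on UNIV (cutoff_poly q)"
proof -
  from assms obtain h where h: "q = bump * h" by (auto elim: dvdE)
  have "cutoff_poly q = (\<lambda>t. max 0 (t * (1 - t)) * poly h t)"
  proof
    fix t :: real
    have "t * (1 - t) \<ge> 0 \<longleftrightarrow> t \<in> {0..1}"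
      by (auto simp: zero_le_mult_iff)
    then show "cutoff_poly q t = max 0 (t * (1 - t)) * poly h t"
      unfolding cutoff_poly_def h poly_mult poly_bump by auto
  qed
  moreover have "continuous_on UNIV (\<lambda>t. max 0 (t * (1 - t)) * poly h t)"
    by (intro continuous_intros)
  ultimately show ?thesis by simp
qed

text \<open>Only the ends 0 and 1 are delicate. There each difference quotient is either that of
  \<open>q\<close> or zero, hence dominated by that of \<open>q\<close>, which tends to 0 because of
  the double zero.\<close>

lemma has_real_derivative_cutoff_poly:
  assumes "bump ^ 2 dvd q"
  shows "(cutoff_poly q has_real_derivative cutoff_poly (pderiv q) t) (at t)"
proof -
  have "bump dvd q"
    using assms dvd_trans[OF dvd_power[of 2 bump]] by simp
  then have q0: "poly q 0 = 0" "poly q 1 = 0"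
    by (auto elim!: dvdE simp: poly_bump)
  have "bump dvd pderiv q"
    using dvd_pderiv_of_power_dvd[of bump 1 q] assms by (simp add: numeral_2_eq_2)
  then have q1: "poly (pderiv q) 0 = 0" "poly (pderiv q) 1 = 0"
    by (auto elim!: dvdE simp: poly_bump)
  consider "t < 0 \<or> t > 1" | "0 < t" "t < 1" | "t = 0 \<or> t = 1" by linarith
  then show ?thesis
  proof cases
    case 1
    then have "t \<in> - {0..1}" by auto
    have "((\<lambda>_. 0) has_real_derivative 0) (at t)" by simp
    then have "(cutoff_poly q has_real_derivative 0) (at t)"
      by (rule has_field_derivative_transform_within_open[where S = "- {0..1}"])
         (use 1 in \<open>auto simp: cutoff_poly_def\<close>)
    then show ?thesis using 1 by (auto simp: cutoff_poly_def)
  next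
    case 2
    have "(cutoff_poly q has_real_derivative poly (pderiv q) t) (at t)"
      by (rule has_field_derivative_transform_within_open[OF poly_DERIV, where S = "{0<..<1}"])
         (use 2 in \<open>auto simp: cutoff_poly_def\<close>)
    then show ?thesis using 2 by (auto simp: cutoff_poly_def)
  next
    case 3
    have "((\<lambda>y. (poly q y - poly q t) / (y - t)) \<longlongrightarrow> poly (pderiv q) t) (at t)"
      using poly_DERIV[of q t] by (simp add: has_field_derivative_iff)
    moreover have "poly (pderiv q) t = 0"
      using 3 q1 by auto
    ultimately have "((\<lambda>y. norm ((poly q y - poly q t) / (y - t))) \<longlongrightarrow> 0) (at t)"
      by (intro tendsto_norm_zero) simp
    then have "((\<lambda>y. (cutoff_poly q y - cutoff_poly q t) / (y - t)) \<longlongrightarrow> 0) (at t)"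
      using 3 q0 by (elim Lim_null_comparison[rotated]) (auto simp: cutoff_poly_def)
    then show ?thesis
      using 3 q1 by (auto simp: has_field_derivative_iff cutoff_poly_def)
  qed
qed

definition logbump :: "real \<Rightarrow> real \<Rightarrow> real poly \<Rightarrow> real \<Rightarrow> real" where
  "logbump \<epsilon> s q r = r powr s * cutoff_poly q (\<epsilon> * ln r)"

text \<open>
  In the variable \<open>t = \<epsilon> * ln r\<close> the operator \<open>r d/dr\<close> acts on \<open>r powr a * q t\<close> as
  \<open>a + \<epsilon> d/dt\<close> acts on \<open>q\<close>.
\<close>
definition euler_op :: "real \<Rightarrow> real \<Rightarrow> real poly \<Rightarrow> real poly" where
  "euler_op \<epsilon> a q = smult a q + smult \<epsilon> (pderiv q)"

section \<open>Derivatives and Laplacians of logarithmic bumps\<close>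

lemma bump_power_dvd_euler_op:
  assumes "bump ^ Suc k dvd q"
  shows "bump ^ k dvd euler_op \<epsilon> a q"
proof -
  have "bump ^ k dvd q"
    using assms by (metis dvd_trans dvd_triv_right power_Suc)
  then show ?thesis
    unfolding euler_op_def by (intro dvd_add dvd_smult dvd_pderiv_of_power_dvd assms)
qed

lemma cutoff_poly_euler_op:
  "cutoff_poly (euler_op \<epsilon> a q) t = a * cutoff_poly q t + \<epsilon> * cutoff_poly (pderiv q) t"
  by (simp add: euler_op_def cutoff_poly_def)

lemma logbump_euler_op:
  "logbump \<epsilon> s (euler_op \<epsilon> a q) r = a * logbump \<epsilon> s q r + \<epsilon> * logbump \<epsilon> s (pderiv q) r"
  by (simp add: logbump_def cutoff_poly_euler_op algebra_simps)

lemma has_real_derivative_logbump: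
  assumes "bump ^ 2 dvd q" "r > 0"
  shows "(logbump \<epsilon> s q has_real_derivative logbump \<epsilon> (s - 1) (euler_op \<epsilon> s q) r) (at r)"
proof -
  have "((\<lambda>r. \<epsilon> * ln r) has_real_derivative \<epsilon> / r) (at r)"
    using assms(2) by (auto intro!: derivative_eq_intros)
  from DERIV_chain2[OF has_real_derivative_cutoff_poly[OF assms(1)] this]
  have 1: "((\<lambda>r. cutoff_poly q (\<epsilon> * ln r)) has_real_derivative
    cutoff_poly (pderiv q) (\<epsilon> * ln r) * (\<epsilon> / r)) (at r)" .
  have 2: "((\<lambda>r. r powr s) has_real_derivative s * r powr (s - 1)) (at r)"
    using assms(2) by (auto intro!: derivative_eq_intros)
  have "r powr s = r * r powr (s - 1)"
    using assms(2) by (simp add: powr_diff)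
  then show ?thesis
    using DERIV_mult[OF 2 1] assms(2) unfolding logbump_def[abs_def]
    by (simp add: cutoff_poly_euler_op algebra_simps)
qed

lemma continuous_on_logbump:
  assumes "bump dvd q"
  shows "continuous_on {0<..} (logbump \<epsilon> s q)"
  unfolding logbump_def[abs_def]
  by (intro continuous_intros continuous_on_compose2[OF continuous_cutoff_poly[OF assms]]) auto

lemma Ck_on_logbump:
  assumes "bump ^ Suc k dvd q"
  shows "Ck_on k (UNIV - {0}) (\<lambda>x :: real^'n. logbump \<epsilon> s q (norm x))"
  using assms
proof (induction k arbitrary: s q)
  case 0
  then have "continuous_on (UNIV - {0}) (\<lambda>x :: real^'n. logbump \<epsilon> s q (norm x))"
    by (intro continuous_on_compose2[OF continuous_on_logbump] continuous_intros) auto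
  then show ?case by simp
next
  case (Suc k)
  have op: "open (UNIV - {0 :: real^'n})" by (simp add: open_delete)
  have "bump ^ 2 dvd q"
    using Suc.prems by (rule power_le_dvd) simp
  note der = has_real_derivative_logbump[OF this, of _ \<epsilon> s]
  have "Ck_on k (UNIV - {0}) (partial i (\<lambda>x :: real^'n. logbump \<epsilon> s q (norm x)))" for i
  proof (rule Ck_on_cong[OF op])
    \<comment> \<open>A partial derivative is again a bump times a coordinate. One power of the
      radius is lost by differentiation and one by the factor \<open>x $ i / norm x\<close>, hence
      \<open>s - 2\<close>.\<close>
    show "Ck_on k (UNIV - {0}) (\<lambda>x :: real^'n. logbump \<epsilon> (s - 2) (euler_op \<epsilon> s q) (norm x) * x $ i)"
      by (intro Ck_on_mult op Suc.IH Ck_on_component bump_power_dvd_euler_op Suc.prems)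
    fix x :: "real^'n" assume "x \<in> UNIV - {0}"
    moreover have "r powr (s - 2) = r powr (s - 1) / r" if "r > 0" for r
      using that by (simp add: powr_diff power2_eq_square)
    ultimately show "logbump \<epsilon> (s - 2) (euler_op \<epsilon> s q) (norm x) * x $ i =
       partial i (\<lambda>x. logbump \<epsilon> s q (norm x)) x"
      by (subst partial_radial[OF der]) (auto simp: logbump_def)
  qed
  moreover have "(\<lambda>x. logbump \<epsilon> s q (norm x)) differentiable (at x)" if "x \<noteq> 0" for x :: "real^'n"
    using has_derivative_radial[OF der, of x] that by (auto simp: differentiable_def)
  ultimately show ?case by simp
qed

lemma logbump_eq_0:
  assumes "\<epsilon> > 0" "r \<ge> 0" "r \<notin> {1..exp (1 / \<epsilon>)}"
  shows "logbump \<epsilon> s q r = 0"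
\<comment> \<open>At the origin the value is 0 by the convention \<open>0 powr s = 0\<close>,
  independently of the logarithm.\<close>
proof (cases "r = 0")
  case False
  then have "r > 0" using assms by simp
  then have "\<epsilon> * ln r \<notin> {0..1}"
    using assms ln_ge_zero_iff[of r] ln_le_cancel_iff[of r "exp (1 / \<epsilon>)"]
    by (auto simp: field_simps zero_le_mult_iff)
  then show ?thesis by (auto simp: logbump_def cutoff_poly_def)
qed (simp add: logbump_def)

text \<open>With T = r d/dr, the radial Laplacian is r^(-2) (T + n - 2) T, and on
  \<open>r powr s\<close> times a profile T acts as \<open>s\<close> plus \<epsilon> d/dt. The
  equation includes the origin, so it can be iterated as an equation of functions.\<close>

lemma laplacian_logbump:
  assumes "bump ^ 3 dvd q" "\<epsilon> > 0"
  shows "laplacian (\<lambda>x :: real^'n. logbump \<epsilon> s q (norm x)) =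
    (\<lambda>x. logbump \<epsilon> (s - 2) (euler_op \<epsilon> (s + CARD('n) - 2) (euler_op \<epsilon> s q)) (norm x))"
proof
  fix x :: "real^'n"
  let ?g = "\<lambda>x :: real^'n. logbump \<epsilon> s q (norm x)"
  have q2: "bump ^ 2 dvd q"
    using assms(1) by (rule power_le_dvd) simp
  have q3: "bump ^ 2 dvd euler_op \<epsilon> s q"
    using assms(1) by (intro bump_power_dvd_euler_op) (simp add: eval_nat_numeral)
  show "laplacian ?g x = logbump \<epsilon> (s - 2) (euler_op \<epsilon> (s + CARD('n) - 2) (euler_op \<epsilon> s q)) (norm x)"
  proof (cases "x = 0")
    case True
    have "laplacian ?g x = 0"
      by (rule laplacian_eq_0[of "ball 0 1"]) (use True assms(2) in \<open>auto intro!: logbump_eq_0\<close>)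
    then show ?thesis using True by (simp add: logbump_def)
  next
    case False
    define r where "r = norm x"
    have r: "r > 0" using False by (simp add: r_def)
    have "laplacian ?g x = logbump \<epsilon> (s - 1 - 1) (euler_op \<epsilon> (s - 1) (euler_op \<epsilon> s q)) r
         + (real CARD('n) - 1) / r * logbump \<epsilon> (s - 1) (euler_op \<epsilon> s q) r"
      unfolding r_def using False
      by (intro laplacian_radial has_real_derivative_logbump q2 q3) auto
    also have "logbump \<epsilon> (s - 1) (euler_op \<epsilon> s q) r = r * logbump \<epsilon> (s - 2) (euler_op \<epsilon> s q) r"
      using r by (simp add: logbump_def powr_diff power2_eq_square)
    also have "(real CARD('n) - 1) / r * (r * logbump \<epsilon> (s - 2) (euler_op \<epsilon> s q) r) =
        (real CARD('n) - 1) * logbump \<epsilon> (s - 2) (euler_op \<epsilon> s q) r"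
      using r by simp
    finally show ?thesis
      unfolding r_def[symmetric] by (simp add: logbump_euler_op[of _ _ _ "euler_op \<epsilon> s q"] algebra_simps)
  qed
qed

text \<open>The profile left after \<open>j\<close> Laplacians of a bump with exponent
  \<open>s\<close>. The innermost Laplacian is peeled off first, so the recursive call continues
  with \<open>s - 2\<close>.\<close>

fun test_poly :: "nat \<Rightarrow> nat \<Rightarrow> real \<Rightarrow> real \<Rightarrow> real poly \<Rightarrow> real poly" where
  "test_poly n 0 \<epsilon> s q = q"
| "test_poly n (Suc j) \<epsilon> s q = test_poly n j \<epsilon> (s - 2) (euler_op \<epsilon> (s + n - 2) (euler_op \<epsilon> s q))"

lemma bump_power_dvd_test_poly:
  "bump ^ (2 * j + k) dvd q \<Longrightarrow> bump ^ k dvd test_poly n j \<epsilon> s q"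
proof (induction j arbitrary: s q)
  case (Suc j)
  have "bump ^ Suc (Suc (2 * j + k)) dvd q"
    using Suc.prems by simp
  then have "bump ^ (2 * j + k) dvd euler_op \<epsilon> (s + n - 2) (euler_op \<epsilon> s q)"
    by (intro bump_power_dvd_euler_op)
  then show ?case using Suc.IH by simp
qed simp

lemma laplacian_iterate_logbump:
  assumes "bump ^ (2 * j + 1) dvd q" "\<epsilon> > 0"
  shows "(laplacian ^^ j) (\<lambda>x :: real^'n. logbump \<epsilon> s q (norm x)) =
    (\<lambda>x. logbump \<epsilon> (s - 2 * j) (test_poly CARD('n) j \<epsilon> s q) (norm x))"
  using assms(1)
proof (induction j arbitrary: s q)
  case (Suc j)
  have "bump ^ Suc (Suc (2 * j + 1)) dvd q"
    using Suc.prems by simp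
  then have d: "bump ^ (2 * j + 1) dvd euler_op \<epsilon> (s + CARD('n) - 2) (euler_op \<epsilon> s q)"
    by (intro bump_power_dvd_euler_op)
  have "bump ^ 3 dvd q"
    using Suc.prems by (rule power_le_dvd) simp
  then have "(laplacian ^^ Suc j) (\<lambda>x :: real^'n. logbump \<epsilon> s q (norm x)) =
    (laplacian ^^ j) (\<lambda>x. logbump \<epsilon> (s - 2) (euler_op \<epsilon> (s + CARD('n) - 2) (euler_op \<epsilon> s q)) (norm x))"
    by (simp add: funpow_Suc_right laplacian_logbump assms(2) del: funpow.simps)
  also have "\<dots> = (\<lambda>x. logbump \<epsilon> (s - 2 * Suc j) (test_poly CARD('n) (Suc j) \<epsilon> s q) (norm x))"
    unfolding Suc.IH[OF d] by (simp add: algebra_simps)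
  finally show ?case .
qed simp

section \<open>Sharpness\<close>

text \<open>
  The factor \<open>\<epsilon> ^ k\<close> collects the operators \<^term>\<open>euler_op \<epsilon> 0\<close>, which lower the degree and
  vanish at \<open>\<epsilon> = 0\<close>; \<open>d\<close> is the number of further such operators that the family survives.
\<close>
definition nondegenerate_family :: "nat \<Rightarrow> (real \<Rightarrow> real poly) \<Rightarrow> bool" where
  "nondegenerate_family d F \<longleftrightarrow> (\<exists>k M R. (\<forall>\<epsilon>. F \<epsilon> = smult (\<epsilon> ^ k) (R \<epsilon>)) \<and>
     (\<forall>i. continuous_on UNIV (\<lambda>\<epsilon>. coeff (R \<epsilon>) i)) \<and> (\<forall>\<epsilon>. degree (R \<epsilon>) \<le> M) \<and>
     R 0 \<noteq> 0 \<and> d \<le> degree (R 0))"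

lemma nondegenerate_family_const: "q \<noteq> 0 \<Longrightarrow> d \<le> degree q \<Longrightarrow> nondegenerate_family d (\<lambda>_. q)"
  unfolding nondegenerate_family_def
  by (intro exI[of _ 0] exI[of _ "degree q"] exI[of _ "\<lambda>_. q"]) auto

text \<open>If \<open>a = 0\<close>, the operator is \<epsilon> times differentiation: the
  \<epsilon> joins the common power, and the degree at 0 drops by one. Otherwise the limit at 0 is
  the nonzero multiple \<open>smult a (R 0)\<close> of the same degree. Either way at most one
  degree is spent.\<close>

lemma nondegenerate_family_euler_op:
  assumes "nondegenerate_family (Suc d) F"
  shows "nondegenerate_family d (\<lambda>\<epsilon>. euler_op \<epsilon> a (F \<epsilon>))"
proof -
  from assms obtain k M R where R: "\<And>\<epsilon>. F \<epsilon> = smult (\<epsilon> ^ k) (R \<epsilon>)"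
    "\<And>i. continuous_on UNIV (\<lambda>\<epsilon>. coeff (R \<epsilon>) i)" "\<And>\<epsilon>. degree (R \<epsilon>) \<le> M"
    "R 0 \<noteq> 0" "Suc d \<le> degree (R 0)"
    unfolding nondegenerate_family_def by blast
  have deg: "degree (pderiv (R \<epsilon>)) \<le> M" for \<epsilon>
    using R(3)[of \<epsilon>] by (simp add: degree_pderiv)
  show ?thesis
  proof (cases "a = 0")
    case True
    have "pderiv (R 0) \<noteq> 0"
      using R(5) by (simp add: pderiv_eq_0_iff)
    then show ?thesis
      unfolding nondegenerate_family_def using R(5) deg True
      by (intro exI[of _ "Suc k"] exI[of _ M] exI[of _ "\<lambda>\<epsilon>. pderiv (R \<epsilon>)"])
         (auto simp: R(1) euler_op_def pderiv_smult coeff_pderiv degree_pderiv intro!: continuous_intros R(2))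
  next
    case False
    have "degree (smult a (R \<epsilon>) + smult \<epsilon> (pderiv (R \<epsilon>))) \<le> M" for \<epsilon>
      by (intro degree_add_le order.trans[OF degree_smult_le] R(3) deg)
    then show ?thesis
      unfolding nondegenerate_family_def using R(4,5) False
      by (intro exI[of _ k] exI[of _ M] exI[of _ "\<lambda>\<epsilon>. smult a (R \<epsilon>) + smult \<epsilon> (pderiv (R \<epsilon>))"])
         (auto simp: R(1) euler_op_def pderiv_smult coeff_pderiv smult_add_right mult.commute
               intro!: continuous_intros R(2))
  qed
qed

lemma nondegenerate_family_test_poly:
  "nondegenerate_family (2 * j + d) F \<Longrightarrow> nondegenerate_family d (\<lambda>\<epsilon>. test_poly n j \<epsilon> s (F \<epsilon>))"
proof (induction j arbitrary: s F)
  case (Suc j)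
  then have "nondegenerate_family (Suc (Suc (2 * j + d))) F" by simp
  then have "nondegenerate_family (2 * j + d) (\<lambda>\<epsilon>. euler_op \<epsilon> (s + n - 2) (euler_op \<epsilon> s (F \<epsilon>)))"
    by (intro nondegenerate_family_euler_op)
  then show ?case by (simp add: Suc.IH)
qed simp

section \<open>Passage to the limit in the profile integrals\<close>

lemma continuous_integral_poly_powr:
  fixes R :: "real \<Rightarrow> real poly"
  assumes "\<And>i. continuous_on UNIV (\<lambda>\<epsilon>. coeff (R \<epsilon>) i)" "\<And>\<epsilon>. degree (R \<epsilon>) \<le> M" "p > 0"
  shows "continuous_on UNIV (\<lambda>\<epsilon>. integral {0..1} (\<lambda>t. \<bar>poly (R \<epsilon>) t\<bar> powr p))"
proof -
  \<comment> \<open>The uniform degree bound gives a sum with a fixed range, hence joint continuity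
    in \<epsilon> and \<open>t\<close>.\<close>
  have poly: "poly (R \<epsilon>) t = (\<Sum>i\<le>M. coeff (R \<epsilon>) i * t ^ i)" for \<epsilon> t
    unfolding poly_altdef using assms(2)
    by (intro sum.mono_neutral_left) (auto simp: coeff_eq_0)
  have "continuous_on (UNIV \<times> cbox 0 1) (\<lambda>(\<epsilon>, t). \<bar>poly (R \<epsilon>) t\<bar> powr p)"
    unfolding poly case_prod_unfold
    by (intro continuous_intros continuous_on_compose2[OF assms(1)] assms(3)) auto
  from integral_continuous_on_param[OF this] show ?thesis by simp
qed

text \<open>A continuous nonnegative integrand with integral zero vanishes on [0,1], but a nonzero
  polynomial has only finitely many roots.\<close>

lemma integral_poly_powr_pos:
  fixes q :: "real poly"
  assumes "q \<noteq> 0" "p > 0"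
  shows "integral {0..1} (\<lambda>t. \<bar>poly q t\<bar> powr p) > 0"
proof -
  have "integral {0..1} (\<lambda>t. \<bar>poly q t\<bar> powr p) \<noteq> 0"
  proof
    assume "integral {0..1} (\<lambda>t. \<bar>poly q t\<bar> powr p) = 0"
    then have "\<forall>t\<in>{0..1}. \<bar>poly q t\<bar> powr p = 0"
      using assms(2) by (subst (asm) integral_eq_0_iff) (auto intro!: continuous_intros)
    then have "{0..1} \<subseteq> {t. poly q t = 0}" by auto
    then show False
      using finite_subset[OF _ poly_roots_finite[OF assms(1)]] infinite_Icc[of "0::real" 1] by simp
  qed
  moreover have "integral {0..1} (\<lambda>t. \<bar>poly q t\<bar> powr p) \<ge> 0"
    by (intro Henstock_Kurzweil_Integration.integral_nonneg integrable_continuous_real continuous_intros assms) auto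
  ultimately show ?thesis by simp
qed

text \<open>After division by the common power of \<epsilon>, both sides are continuous at
  \<epsilon> = 0. There the operator is multiplication by \<open>b\<close>, and the remaining
  integral is positive because \<open>R 0\<close> is nonzero.\<close>

lemma euler_op_integral_bound:
  assumes F: "nondegenerate_family d F" and p: "p > 0"
    and le: "\<And>\<epsilon>. \<epsilon> > 0 \<Longrightarrow> C * integral {0..1} (\<lambda>t. \<bar>poly (F \<epsilon>) t\<bar> powr p)
      \<le> integral {0..1} (\<lambda>t. \<bar>poly (euler_op \<epsilon> b (F \<epsilon>)) t\<bar> powr p)"
  shows "C \<le> \<bar>b\<bar> powr p"
proof -
  from F obtain k M R where R: "\<And>\<epsilon>. F \<epsilon> = smult (\<epsilon> ^ k) (R \<epsilon>)"
    "\<And>i. continuous_on UNIV (\<lambda>\<epsilon>. coeff (R \<epsilon>) i)" "\<And>\<epsilon>. degree (R \<epsilon>) \<le> M"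
    "R 0 \<noteq> 0"
    unfolding nondegenerate_family_def by blast
  define I where "I = (\<lambda>\<epsilon>. integral {0..1} (\<lambda>t. \<bar>poly (R \<epsilon>) t\<bar> powr p))"
  define J where "J = (\<lambda>\<epsilon>. integral {0..1} (\<lambda>t. \<bar>poly (euler_op \<epsilon> b (R \<epsilon>)) t\<bar> powr p))"
  have cI: "continuous_on UNIV I"
    unfolding I_def by (rule continuous_integral_poly_powr[OF R(2,3) p])
  have "degree (pderiv (R \<epsilon>)) \<le> M" for \<epsilon>
    using R(3)[of \<epsilon>] by (simp add: degree_pderiv)
  then have "degree (euler_op \<epsilon> b (R \<epsilon>)) \<le> M" for \<epsilon>
    unfolding euler_op_def by (intro degree_add_le order.trans[OF degree_smult_le] R(3))
  then have cJ: "continuous_on UNIV J"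
    unfolding J_def
    by (intro continuous_integral_poly_powr[OF _ _ p])
       (auto simp: euler_op_def coeff_pderiv intro!: continuous_intros R(2))
  have "C * I \<epsilon> \<le> J \<epsilon>" if \<epsilon>: "\<epsilon> > 0" for \<epsilon>
  proof -
    define a where "a = (\<epsilon> ^ k) powr p"
    have a: "a > 0" using \<epsilon> by (simp add: a_def)
    have "euler_op \<epsilon> b (F \<epsilon>) = smult (\<epsilon> ^ k) (euler_op \<epsilon> b (R \<epsilon>))"
      by (simp add: R(1) euler_op_def pderiv_smult smult_add_right mult.commute)
    then have "a * (C * I \<epsilon>) \<le> a * J \<epsilon>"
      using le[OF \<epsilon>] \<epsilon> by (simp add: R(1) I_def J_def a_def abs_mult powr_mult mult.left_commute)
    then show ?thesis using a by simp
  qed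
  then have "eventually (\<lambda>\<epsilon>. C * I \<epsilon> \<le> J \<epsilon>) (at_right 0)"
    by (auto simp: eventually_at_filter)
  moreover have "(I \<longlongrightarrow> I 0) (at_right 0)" "(J \<longlongrightarrow> J 0) (at_right 0)"
    using cI cJ by (auto simp: continuous_on_eq_continuous_at isCont_def filterlim_at_split)
  ultimately have "C * I 0 \<le> J 0"
    by (intro tendsto_le[OF _ _ tendsto_mult_left]) auto
  also have "J 0 = \<bar>b\<bar> powr p * I 0"
    by (simp add: J_def I_def euler_op_def abs_mult powr_mult)
  finally show ?thesis
    using integral_poly_powr_pos[OF R(4) p] by (simp add: I_def)
qed

text \<open>The condition on the exponents leaves the measure dr/r, and t = \<epsilon> ln r maps
  [1, exp (1/\<epsilon>)] onto [0,1] with dr/r = dt/\<epsilon>. The prefactor is therefore common to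
  the gradient and Laplacian integrals.\<close>

lemma integral_logbump:
  fixes \<beta> \<epsilon> s p :: real
  assumes "bump dvd q" "\<epsilon> > 0" "p > 0" "\<beta> + s * p + CARD('n) = 0"
  shows "(LINT x|lborel. norm (x :: real^'n) powr \<beta> * \<bar>logbump \<epsilon> s q (norm x)\<bar> powr p) =
    unit_ball_vol (real CARD('n)) * CARD('n) / \<epsilon> * integral {0..1} (\<lambda>t. \<bar>poly q t\<bar> powr p)"
proof -
  have DIM: "DIM(real^'n) = CARD('n)" by simp
  define b where "b = exp (1 / \<epsilon>)"
  have b: "1 \<le> b" "\<epsilon> * ln b = 1" using assms(2) by (auto simp: b_def)
  have polar: "(LINT x|lborel. norm (x :: real^'n) powr \<beta> * \<bar>logbump \<epsilon> s q (norm x)\<bar> powr p) =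
    unit_ball_vol (real CARD('n)) * CARD('n) *
      integral {1..b} (\<lambda>r. r ^ (CARD('n) - 1) * (r powr \<beta> * \<bar>logbump \<epsilon> s q r\<bar> powr p))"
    unfolding DIM[symmetric]
  proof (rule integral_norm_lborel_Icc)
    have "continuous_on {1..b} (logbump \<epsilon> s q)"
      using continuous_on_logbump[OF assms(1)] by (rule continuous_on_subset) auto
    then show "continuous_on {1..b} (\<lambda>r. r powr \<beta> * \<bar>logbump \<epsilon> s q r\<bar> powr p)"
      using assms(3) by (intro continuous_intros) auto
    show "norm x powr \<beta> * \<bar>logbump \<epsilon> s q (norm x)\<bar> powr p =
      (if norm x \<in> {1..b} then norm x powr \<beta> * \<bar>logbump \<epsilon> s q (norm x)\<bar> powr p else 0)" for x :: "real^'n"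
      using logbump_eq_0[OF assms(2), of "norm x" s q] by (auto simp: b_def)
  qed simp
  have "((\<lambda>r. (\<epsilon> / r) *\<^sub>R \<bar>poly q (\<epsilon> * ln r)\<bar> powr p) has_integral
      integral {\<epsilon> * ln 1..\<epsilon> * ln b} (\<lambda>t. \<bar>poly q t\<bar> powr p)) {1..b}"
  proof (rule has_integral_substitution)
    show "(\<lambda>r. \<epsilon> * ln r) ` {1..b} \<subseteq> {0..1}"
    proof clarify
      fix r assume r: "r \<in> {1..b}"
      then have "ln r \<le> ln b" by simp
      then have "\<epsilon> * ln r \<le> \<epsilon> * ln b" using assms(2) by simp
      with r b assms(2) show "\<epsilon> * ln r \<in> {0..1}" by simp
    qed
    show "((\<lambda>r. \<epsilon> * ln r) has_real_derivative \<epsilon> / r) (at r within {1..b})" if "r \<in> {1..b}" for r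
      using that by (auto intro!: derivative_eq_intros)
  qed (use b assms in \<open>auto intro!: continuous_intros\<close>)
  then have subst: "integral {1..b} (\<lambda>r. (\<epsilon> / r) * \<bar>poly q (\<epsilon> * ln r)\<bar> powr p) =
      integral {0..1} (\<lambda>t. \<bar>poly q t\<bar> powr p)"
    using b by (simp add: integral_unique)
  have "r ^ (CARD('n) - 1) * (r powr \<beta> * \<bar>logbump \<epsilon> s q r\<bar> powr p) =
      1 / \<epsilon> * ((\<epsilon> / r) * \<bar>poly q (\<epsilon> * ln r)\<bar> powr p)" if r: "r \<in> {1..b}" for r
  proof -
    have r0: "r > 0" using r by simp
    have "ln r \<le> ln b" using r by simp
    then have "\<epsilon> * ln r \<le> \<epsilon> * ln b" using assms(2) by simp
    then have c: "cutoff_poly q (\<epsilon> * ln r) = poly q (\<epsilon> * ln r)"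
      using r b assms(2) by (simp add: cutoff_poly_def)
    have e: "real (CARD('n) - 1) + \<beta> + s * p = -1"
      using assms(4) by (simp add: of_nat_diff)
    have "r ^ (CARD('n) - 1) * (r powr \<beta> * (r powr s) powr p) = r powr (real (CARD('n) - 1) + \<beta> + s * p)"
      unfolding powr_realpow[OF r0, symmetric] using r0 by (simp add: powr_add powr_powr)
    also have "\<dots> = 1 / r"
      unfolding e using r0 by (simp add: powr_minus_divide)
    finally show ?thesis
      using assms(2) by (simp add: logbump_def c abs_mult powr_mult mult.assoc[symmetric])
  qed
  then have "integral {1..b} (\<lambda>r. r ^ (CARD('n) - 1) * (r powr \<beta> * \<bar>logbump \<epsilon> s q r\<bar> powr p)) =
      integral {1..b} (\<lambda>r. 1 / \<epsilon> * ((\<epsilon> / r) * \<bar>poly q (\<epsilon> * ln r)\<bar> powr p))"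
    by (intro Henstock_Kurzweil_Integration.integral_cong)
  also have "\<dots> = 1 / \<epsilon> * integral {0..1} (\<lambda>t. \<bar>poly q t\<bar> powr p)"
    unfolding subst[symmetric] by (rule Henstock_Kurzweil_Integration.integral_mult_right)
  finally show ?thesis
    unfolding polar by simp
qed

lemma logbump_in_Ccr_punctured:
  assumes "bump ^ Suc k dvd q" "\<epsilon> > 0"
  shows "(\<lambda>x :: real^'n. logbump \<epsilon> s q (norm x)) \<in> Ccr_punctured k"
proof (rule Ccr_puncturedI[where a = 1])
  have "norm x \<in> {1..exp (1 / \<epsilon>)}" if "logbump \<epsilon> s q (norm x) \<noteq> 0" for x :: "real^'n"
    using logbump_eq_0[OF assms(2), of "norm x" s q] that by force
  then show "radial_on_annulus k 1 (exp (1 / \<epsilon>)) (\<lambda>x :: real^'n. logbump \<epsilon> s q (norm x))"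
    using Ck_on_logbump[OF assms(1)] by (force simp: radial_on_annulus_def radially_symmetric_def)
qed simp

lemma norm_grad_logbump:
  assumes "bump ^ 2 dvd q" "\<epsilon> > 0"
  shows "norm (grad (\<lambda>x :: real^'n. logbump \<epsilon> s q (norm x)) x) = \<bar>logbump \<epsilon> (s - 1) (euler_op \<epsilon> s q) (norm x)\<bar>"
proof (cases "x = 0")
  case True
  have "partial i (\<lambda>x :: real^'n. logbump \<epsilon> s q (norm x)) 0 = 0" for i
    by (rule partial_eq_0[of "ball 0 1"]) (use assms(2) in \<open>auto intro!: logbump_eq_0\<close>)
  then have "grad (\<lambda>x :: real^'n. logbump \<epsilon> s q (norm x)) 0 = 0"
    by (simp add: grad_def vec_eq_iff)
  then show ?thesis using True by (simp add: logbump_def[of _ "s - 1"])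
next
  case False
  then show ?thesis
    by (intro norm_grad_radial has_real_derivative_logbump assms) auto
qed

lemma hardy_radial_constant_sharp:
  fixes \<alpha> p C :: real and m :: nat
  assumes p: "p > 1" and C: "\<And>u. u \<in> (Ccr_punctured (2 * Suc m) :: (real^'n \<Rightarrow> real) set) \<Longrightarrow>
    C * (LINT x|lborel. norm x powr (\<alpha> - p) * norm (grad ((laplacian ^^ m) u) x) powr p)
    \<le> (LINT x|lborel. norm x powr \<alpha> * \<bar>(laplacian ^^ Suc m) u x\<bar> powr p)"
  shows "C \<le> \<bar>real CARD('n) - (real CARD('n) + \<alpha>) / p\<bar> powr p"
proof -
  \<comment> \<open>The exponent of the \<open>m\<close>-th iterated Laplacian of the test function.
    It solves both \<alpha> - p + (s - 1) p + n = 0 for the gradient and \<alpha> + (s - 2) p + n =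
    0 for the next Laplacian. The test function itself starts at \<open>s + 2 * m\<close>.\<close>
  define s where "s = 2 - (CARD('n) + \<alpha>) / p"
  \<comment> \<open>One power more than the required order of smoothness; three powers remain after
    \<open>m\<close> Laplacians, as one further Laplacian demands.\<close>
  define q where "q = bump ^ Suc (2 * Suc m)"
  define Q where "Q = (\<lambda>\<epsilon>. test_poly CARD('n) m \<epsilon> (s + 2 * m) q)"
  define F where "F = (\<lambda>\<epsilon>. euler_op \<epsilon> s (Q \<epsilon>))"
  have Q: "bump ^ 3 dvd Q \<epsilon>" for \<epsilon>
    unfolding Q_def q_def by (rule bump_power_dvd_test_poly) (simp add: eval_nat_numeral)
  have sp: "s * p = 2 * p - (CARD('n) + \<alpha>)"
    using p by (simp add: s_def field_simps)
  have "degree q = 2 * Suc (2 * Suc m)"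
    unfolding q_def by (subst degree_power_eq) (auto simp: bump_def)
  \<comment> \<open>Two operators for each of the \<open>m\<close> Laplacians and one for the
    gradient.\<close>
  then have "nondegenerate_family (2 * m + 1) (\<lambda>_. q)"
    by (intro nondegenerate_family_const) auto
  then have "nondegenerate_family 0 F"
    unfolding F_def Q_def by (intro nondegenerate_family_euler_op nondegenerate_family_test_poly) simp
  \<comment> \<open>The last Laplacian adds one operator to the gradient profile \<open>F\<close>.
    Its constant \<open>s + n - 2\<close> equals n - (n + \<alpha>)/p.\<close>
  then have "C \<le> \<bar>s + CARD('n) - 2\<bar> powr p"
  proof (rule euler_op_integral_bound)
    fix \<epsilon> :: real assume \<epsilon>: "\<epsilon> > 0"
    define u where "u = (\<lambda>x :: real^'n. logbump \<epsilon> (s + 2 * m) q (norm x))"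
    define c where "c = unit_ball_vol (real CARD('n)) * CARD('n) / \<epsilon>"
    have c: "c > 0" using \<epsilon> by (simp add: c_def)
    have "bump ^ 2 dvd Q \<epsilon>" "bump ^ Suc 2 dvd Q \<epsilon>"
      using Q[of \<epsilon>] power_le_dvd[of bump 3 "Q \<epsilon>" 2] by (auto simp: eval_nat_numeral)
    then have F: "bump ^ Suc 1 dvd F \<epsilon>"
      unfolding F_def using bump_power_dvd_euler_op[of 2 "Q \<epsilon>" \<epsilon> s] by (simp add: eval_nat_numeral)
    have v: "(laplacian ^^ m) u = (\<lambda>x. logbump \<epsilon> s (Q \<epsilon>) (norm x))"
      unfolding u_def Q_def using \<epsilon>
      by (subst laplacian_iterate_logbump) (auto simp: q_def intro!: le_imp_power_dvd simp del: power_Suc)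
    have lv: "(laplacian ^^ Suc m) u = (\<lambda>x. logbump \<epsilon> (s - 2) (euler_op \<epsilon> (s + CARD('n) - 2) (F \<epsilon>)) (norm x))"
      by (simp add: v laplacian_logbump[OF Q \<epsilon>] F_def)
    have F_eq: "euler_op \<epsilon> s (Q \<epsilon>) = F \<epsilon>" by (simp add: F_def)
    have I1: "(LINT x|lborel. norm x powr (\<alpha> - p) * norm (grad ((laplacian ^^ m) u) x) powr p) =
      c * integral {0..1} (\<lambda>t. \<bar>poly (F \<epsilon>) t\<bar> powr p)"
      unfolding v norm_grad_logbump[OF \<open>bump ^ 2 dvd Q \<epsilon>\<close> \<epsilon>] c_def F_eq
      using F p sp \<epsilon> by (intro integral_logbump) (auto simp: algebra_simps intro: dvd_trans[OF dvd_power])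
    have I2: "(LINT x|lborel. norm x powr \<alpha> * \<bar>(laplacian ^^ Suc m) u x\<bar> powr p) =
      c * integral {0..1} (\<lambda>t. \<bar>poly (euler_op \<epsilon> (s + CARD('n) - 2) (F \<epsilon>)) t\<bar> powr p)"
      unfolding lv c_def
      using bump_power_dvd_euler_op[OF F] p sp \<epsilon> by (intro integral_logbump) (auto simp: algebra_simps)
    have "u \<in> Ccr_punctured (2 * Suc m)"
      unfolding u_def q_def by (rule logbump_in_Ccr_punctured[OF dvd_refl \<epsilon>])
    from C[OF this] c
    show "C * integral {0..1} (\<lambda>t. \<bar>poly (F \<epsilon>) t\<bar> powr p)
      \<le> integral {0..1} (\<lambda>t. \<bar>poly (euler_op \<epsilon> (s + CARD('n) - 2) (F \<epsilon>)) t\<bar> powr p)"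
      unfolding I1 I2 by (simp add: mult.left_commute)
  qed (use p in simp)
  then show ?thesis
    by (simp add: s_def algebra_simps)
qed

theorem theorem1p2:
  fixes \<alpha> p :: real and m :: nat
  assumes "CARD('n::finite) \<ge> 2" and "p > 1" and "m \<ge> 1"
  shows "(\<forall>u \<in> (Ccr_punctured (2 * m) :: (real^'n \<Rightarrow> real) set).
            (LINT x|lborel. norm x powr \<alpha> * \<bar>(laplacian ^^ m) u x\<bar> powr p)
              \<ge> \<bar>real CARD('n) - (real CARD('n) + \<alpha>) / p\<bar> powr p *
                (LINT x|lborel. norm x powr (\<alpha> - p) * norm (grad ((laplacian ^^ (m - 1)) u) x) powr p))
       \<and> (\<forall>C::real.
            (\<forall>u \<in> (Ccr_punctured (2 * m) :: (real^'n \<Rightarrow> real) set).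
               (LINT x|lborel. norm x powr \<alpha> * \<bar>(laplacian ^^ m) u x\<bar> powr p)
                 \<ge> C * (LINT x|lborel. norm x powr (\<alpha> - p) * norm (grad ((laplacian ^^ (m - 1)) u) x) powr p))
            \<longrightarrow> C \<le> \<bar>real CARD('n) - (real CARD('n) + \<alpha>) / p\<bar> powr p)"
proof -
  obtain l where m: "m = Suc l"
    using assms(3) by (cases m) auto
  show ?thesis
    unfolding m diff_Suc_1
  proof (intro conjI ballI allI impI)
    fix u :: "real^'n \<Rightarrow> real" assume "u \<in> Ccr_punctured (2 * Suc l)"
    then obtain a b where ab: "0 < a" "radial_on_annulus (2 * Suc l) a b u"
      by (rule Ccr_punctured_imp_radial_on_annulus)
    \<comment> \<open>Of the \<open>2 * Suc l\<close> derivatives, \<open>l\<close> Laplacians leave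
      exactly the two that \<open>hardy_radial\<close> asks for.\<close>
    then have "radial_on_annulus (Suc (Suc 0)) a b ((laplacian ^^ l) u)"
      by (intro radial_on_annulus_laplacian_iterate) auto
    from hardy_radial[OF this ab(1) assms(2), of \<alpha>]
    show "(LINT x|lborel. norm x powr \<alpha> * \<bar>(laplacian ^^ Suc l) u x\<bar> powr p)
      \<ge> \<bar>real CARD('n) - (real CARD('n) + \<alpha>) / p\<bar> powr p *
        (LINT x|lborel. norm x powr (\<alpha> - p) * norm (grad ((laplacian ^^ l) u) x) powr p)"
      by simp
  next
    fix C assume "\<forall>u \<in> (Ccr_punctured (2 * Suc l) :: (real^'n \<Rightarrow> real) set).
      (LINT x|lborel. norm x powr \<alpha> * \<bar>(laplacian ^^ Suc l) u x\<bar> powr p)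
        \<ge> C * (LINT x|lborel. norm x powr (\<alpha> - p) * norm (grad ((laplacian ^^ l) u) x) powr p)"
    then show "C \<le> \<bar>real CARD('n) - (real CARD('n) + \<alpha>) / p\<bar> powr p"
      by (intro hardy_radial_constant_sharp[OF assms(2)]) blast
  qed
qed

end
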